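(* Let $\mathcal{T}\subset\mathcal{K}$ be a database of $n$ objects, let $m\ge1$ and $R\ge1$, and let $D$ be the rank disorder of $\mathcal{T}\cup\{q\}$ for the query object $q\in\mathcal{K}$. There is a procedure with the following two phases: - a learning phase that samples $m$ objects uniformly at random from $\mathcal{T}$ and ranks all objects of $\mathcal{T}$ with respect to them, asking an expected $O(nm\log n)$ oracle questions; - a search phase that, given $q$, returns one of the $R$ nearest neighbors of $q$ in $\mathcal{T}$ with constant probability, asking an expected $m+\log n+D+\frac{D^2n}{mR}+1$ oracle questions.
   Context: Setting: a hidden space $\mathcal{K}$ with distance function $d$, which need not be a metric; all distances are pairwise distinct. The database is $\mathcal{T}\subset\mathcal{K}$ with $|\mathcal{T}|=n$. Access is only via the oracle $O(q,u,v)$, which returns $u$ if $d(u,q)\le d(v,q)$ and $v$ otherwise. Each call is one question. Ranks: $r_v(u,S)=c$ if $u$ is the $c$-th nearest object to $v$ in $S$, with $r_x(x,S)=0$. The rank disorder of a set $S$ is the smallest $D$ such that for all $x,y,z\in S$: $r_x(y,S)\le D(r_z(x,S)+r_z(y,S))$, $r_x(y,S)\le D(r_x(z,S)+r_y(z,S))$, $r_x(y,S)\le D(r_x(z,S)+r_z(y,S))$, and $r_x(y,S)\le D(r_z(x,S)+r_y(z,S))$. The $R$ nearest neighbors of $q$ in $\mathcal{T}$ are the $R$ objects of $\mathcal{T}$ closest to $q$. *)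

theory Defs
  imports "HOL-Probability.Probability"
begin

definition distinct_distances :: "'k set \<Rightarrow> ('k \<Rightarrow> 'k \<Rightarrow> real) \<Rightarrow> bool" where
  "distinct_distances K d \<longleftrightarrow>
     (\<forall>x\<in>K. \<forall>y\<in>K. \<forall>z\<in>K. \<forall>w\<in>K.
        x \<noteq> y \<longrightarrow> z \<noteq> w \<longrightarrow> {x, y} \<noteq> {z, w} \<longrightarrow> d x y \<noteq> d z w)"

definition comparison_oracle :: "('k \<Rightarrow> 'k \<Rightarrow> real) \<Rightarrow> 'k \<Rightarrow> 'k \<Rightarrow> 'k \<Rightarrow> 'k" where
  "comparison_oracle d q u v = (if d u q \<le> d v q then u else v)"

text \<open>
  The rank of \<open>u\<close> with respect to \<open>v\<close>. The object \<open>v\<close> itself always has rank 0 and is not counted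
  among the others, so no assumption on the self-distance \<open>d v v\<close> is needed.
\<close>

definition rank :: "('k \<Rightarrow> 'k \<Rightarrow> real) \<Rightarrow> 'k \<Rightarrow> 'k \<Rightarrow> 'k set \<Rightarrow> nat" where
  "rank d v u S = (if u = v then 0 else card {w \<in> S - {v}. d w v \<le> d u v})"

text \<open>
  The constraint \<open>0 \<le> D\<close> only matters when \<open>S\<close> has at most one element: otherwise taking
  \<open>z = y \<noteq> x\<close> in the third inequality already forces \<open>1 \<le> D\<close>.
\<close>

definition rank_disorder :: "('k \<Rightarrow> 'k \<Rightarrow> real) \<Rightarrow> 'k set \<Rightarrow> real" where
  "rank_disorder d S = (LEAST D. 0 \<le> D \<and>
     (\<forall>x\<in>S. \<forall>y\<in>S. \<forall>z\<in>S.
        real (rank d x y S) \<le> D * (real (rank d z x S) + real (rank d z y S)) \<and>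
        real (rank d x y S) \<le> D * (real (rank d x z S) + real (rank d y z S)) \<and>
        real (rank d x y S) \<le> D * (real (rank d x z S) + real (rank d z y S)) \<and>
        real (rank d x y S) \<le> D * (real (rank d z x S) + real (rank d y z S))))"

text \<open>This is all of \<open>T\<close> when \<open>T\<close> has fewer than \<open>R\<close> objects.\<close>

definition nearest_neighbors :: "('k \<Rightarrow> 'k \<Rightarrow> real) \<Rightarrow> nat \<Rightarrow> 'k \<Rightarrow> 'k set \<Rightarrow> 'k set" where
  "nearest_neighbors d R q T = {u \<in> T. card {w \<in> T. rank d q w T < rank d q u T} < R}"

text \<open>
  For \<open>s \<in> T\<close>: the objects of \<open>T\<close> listed by increasing rank with respect to \<open>s\<close>, starting with
  \<open>s\<close> itself at position 0.
\<close>

definition is_ranking :: "('k \<Rightarrow> 'k \<Rightarrow> real) \<Rightarrow> 'k \<Rightarrow> 'k set \<Rightarrow> 'k list \<Rightarrow> bool" where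
  "is_ranking d s T l \<longleftrightarrow>
     set l = T \<and> length l = card T \<and> (\<forall>i<length l. rank d s (l ! i) T = i)"

text \<open>
  Randomized adaptive algorithms that see the hidden space only through oracle answers:
  \<open>Ask q u v k\<close> asks the question \<open>(q, u, v)\<close> and continues with \<open>k\<close> applied to the answer,
  \<open>Random p\<close> continues with an algorithm drawn from \<open>p\<close>. The distance function occurs only in
  the oracle passed to \<open>run\<close>, which returns the joint distribution of the result and the number
  of questions asked.
\<close>

datatype ('k, 'a) alg =
    Return 'a
  | Ask 'k 'k 'k "'k \<Rightarrow> ('k, 'a) alg"
  | Random "('k, 'a) alg pmf"

primrec run :: "('k \<Rightarrow> 'k \<Rightarrow> 'k \<Rightarrow> 'k) \<Rightarrow> ('k, 'a) alg \<Rightarrow> ('a \<times> nat) pmf" where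
  "run orc (Return a) = return_pmf (a, 0)"
| "run orc (Ask q u v k) = map_pmf (apsnd Suc) (run orc (k (orc q u v)))"
| "run orc (Random p) = join_pmf (map_pmf (run orc) p)"

text \<open>A nonnegative integral, so that an infinite expectation is not silently read as 0.\<close>

definition expected_questions :: "('a \<times> nat) pmf \<Rightarrow> ennreal" where
  "expected_questions P = (\<integral>\<^sup>+ x. of_nat (snd x) \<partial>measure_pmf P)"

end

theory Submission
  imports Defs
begin

text \<open>
  Learning: draw \<open>m\<close> objects and merge sort \<open>T\<close> around each. Search: let \<open>s\<close> be the drawn object
  closest to \<open>q\<close>; with probability at least \<open>1/2\<close> its rank with respect to \<open>q\<close> is at most
  \<open>t = \<lceil>n/m\<rceil>\<close>. Then the disorder inequality puts all \<open>R\<close> nearest neighbours of \<open>q\<close> among the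
  first \<open>D (t + R)\<close> objects around \<open>s\<close>, so \<open>D + D n / (m R)\<close> uniform draws from that initial
  segment contain one of them with constant probability, and the draw closest to \<open>q\<close> is returned.
\<close>

section \<open>Sequencing of randomized query algorithms\<close>

primrec bind_alg :: "('k, 'a) alg \<Rightarrow> ('a \<Rightarrow> ('k, 'b) alg) \<Rightarrow> ('k, 'b) alg" where
  "bind_alg (Return a) f = f a"
| "bind_alg (Ask q u v k) f = Ask q u v (\<lambda>x. bind_alg (k x) f)"
| "bind_alg (Random p) f = Random (map_pmf (\<lambda>A. bind_alg A f) p)"

text \<open>\<open>run\<close> is a monad morphism from decision trees to distributions with an
  additive counter. In the \<open>Random\<close> case both sides are averages over \<open>p\<close>,
  so associativity of \<open>bind_pmf\<close> carries the claim through.\<close>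

lemma run_bind_alg:
  "run orc (bind_alg A f) =
     bind_pmf (run orc A) (\<lambda>(x, c). map_pmf (apsnd ((+) c)) (run orc (f x)))"
proof (induction A)
  case (Return a)
  have "map_pmf (apsnd ((+) 0)) (run orc (f a)) = map_pmf id (run orc (f a))"
    by (intro map_pmf_cong) auto
  then show ?case by (simp add: bind_return_pmf pmf.map_id)
next
  case (Ask q u v k)
  show ?case
    by (auto simp: Ask bind_map_pmf map_bind_pmf pmf.map_comp o_def split_beta
        intro!: bind_pmf_cong map_pmf_cong)
next
  case (Random p)
  have "run orc (bind_alg (Random p) f) = bind_pmf p (\<lambda>A. run orc (bind_alg A f))"
    by (simp add: join_eq_bind_pmf bind_map_pmf)
  also have "\<dots> = bind_pmf p (\<lambda>A. bind_pmf (run orc A)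
      (\<lambda>(x, c). map_pmf (apsnd ((+) c)) (run orc (f x))))"
    by (intro bind_pmf_cong refl Random)
  also have "\<dots> = bind_pmf (run orc (Random p))
      (\<lambda>(x, c). map_pmf (apsnd ((+) c)) (run orc (f x)))"
    by (simp add: join_eq_bind_pmf bind_map_pmf bind_assoc_pmf)
  finally show ?case .
qed

text \<open>For subroutines that are deterministic once the oracle is fixed, such as sorting or
  finding a minimum: their run is a point mass and their cost simply adds on.\<close>

lemma run_bind_alg_return:
  assumes "run orc A = return_pmf (x, c)"
  shows "run orc (bind_alg A f) = map_pmf (apsnd ((+) c)) (run orc (f x))"
  by (simp add: run_bind_alg assms bind_return_pmf)

lemma run_Random_map: "run orc (Random (map_pmf g p)) = bind_pmf p (\<lambda>x. run orc (g x))"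
  by (simp add: join_eq_bind_pmf bind_map_pmf)

section \<open>Expected counts and hitting probabilities\<close>

lemma expected_questions_le:
  assumes "\<And>a c. (a, c) \<in> set_pmf P \<Longrightarrow> real c \<le> B"
  shows "expected_questions P \<le> ennreal B"
proof -
  have "expected_questions P \<le> (\<integral>\<^sup>+ x. ennreal B \<partial>measure_pmf P)"
    unfolding expected_questions_def
  proof (intro nn_integral_mono_AE AE_pmfI)
    fix x assume "x \<in> set_pmf P"
    then have "real (snd x) \<le> B"
      using assms[of "fst x" "snd x"] by simp
    then have "ennreal (real (snd x)) \<le> ennreal B"
      by (rule ennreal_leI)
    then show "of_nat (snd x) \<le> ennreal B"
      by (simp add: ennreal_of_nat_eq_real_of_nat)
  qed
  then show ?thesis by simp
qed

text \<open>Outcomes outside \<open>G\<close> are discarded; integrating the constant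
  \<open>b\<close> over \<open>G\<close> gives the product.\<close>

lemma prob_bind_pmf_ge:
  assumes "a \<le> measure_pmf.prob M G" "0 \<le> b"
    and "\<And>x. x \<in> set_pmf M \<Longrightarrow> x \<in> G \<Longrightarrow> b \<le> measure_pmf.prob (N x) A"
  shows "a * b \<le> measure_pmf.prob (bind_pmf M N) A"
proof -
  have "ennreal (a * b) \<le> ennreal (measure_pmf.prob M G * b)"
    using assms by (intro ennreal_leI mult_right_mono)
  also have "\<dots> = ennreal b * emeasure (measure_pmf M) G"
    using assms(2) by (simp add: measure_pmf.emeasure_eq_measure ennreal_mult' mult.commute)
  also have "\<dots> = (\<integral>\<^sup>+ x. ennreal b * indicator G x \<partial>measure_pmf M)"
    by (simp add: nn_integral_cmult_indicator)
  also have "\<dots> \<le> (\<integral>\<^sup>+ x. emeasure (measure_pmf (N x)) A \<partial>measure_pmf M)"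
    using assms(3)
    by (intro nn_integral_mono_AE AE_pmfI)
      (auto simp: indicator_def measure_pmf.emeasure_eq_measure intro: ennreal_leI)
  also have "\<dots> = ennreal (measure_pmf.prob (bind_pmf M N) A)"
    by (simp add: emeasure_bind_pmf flip: measure_pmf.emeasure_eq_measure)
  finally show ?thesis
    by (simp add: ennreal_le_iff)
qed

lemma lists_of_length_nonempty:
  assumes "S \<noteq> {}"
  shows "{xs. set xs \<subseteq> S \<and> length xs = m} \<noteq> {}"
proof -
  obtain x where "x \<in> S" using assms by auto
  then have "replicate m x \<in> {xs. set xs \<subseteq> S \<and> length xs = m}"
    by (auto simp: set_replicate_conv_if)
  then show ?thesis by blast
qed

lemma set_pmf_uniform_lists:
  assumes "finite S" "S \<noteq> {}"
  shows "set_pmf (pmf_of_set {xs. set xs \<subseteq> S \<and> length xs = m}) =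
    {xs. set xs \<subseteq> S \<and> length xs = m}"
  by (rule set_pmf_of_set[OF lists_of_length_nonempty[OF assms(2)] finite_lists_length_eq[OF assms(1)]])

text \<open>A uniform list is \<open>m\<close> independent draws with replacement, and with
  \<open>g = |G| / |S|\<close> all of them miss \<open>G\<close> with probability \<open>(1 - g) ^ m
  \<le> exp (- m g) \<le> exp (- y) \<le> 1 / (1 + y)\<close>. The rational form gives simple
  constants: \<open>1/2\<close> for \<open>y = 1\<close> and \<open>1/4\<close> for
  \<open>y = 1/3\<close>.\<close>

lemma prob_uniform_list_hits:
  assumes "finite S" "S \<noteq> {}" "G \<subseteq> S" "0 \<le> y" "y \<le> real m * real (card G) / real (card S)"
  shows "y / (1 + y) \<le> measure_pmf.prob (pmf_of_set {xs. set xs \<subseteq> S \<and> length xs = m})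
    {xs. set xs \<inter> G \<noteq> {}}"
proof -
  let ?X = "\<lambda>S. {xs. set xs \<subseteq> S \<and> length xs = m}"
  have pos: "card S > 0" using assms by (simp add: card_gt_0_iff)
  have le: "card G \<le> card S" using assms by (intro card_mono)
  define g where "g = real (card G) / real (card S)"
  have g: "0 \<le> g" "g \<le> 1" using le pos by (auto simp: g_def)
  have "measure_pmf.prob (pmf_of_set (?X S)) (- {xs. set xs \<inter> G \<noteq> {}})
      = real (card (?X S \<inter> - {xs. set xs \<inter> G \<noteq> {}})) / real (card (?X S))"
    using assms
    by (intro measure_pmf_of_set lists_of_length_nonempty finite_lists_length_eq)
  also have "?X S \<inter> - {xs. set xs \<inter> G \<noteq> {}} = ?X (S - G)" by auto
  also have "real (card (?X (S - G))) / real (card (?X S)) = (1 - g) ^ m"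
    using assms pos le
    by (simp add: card_lists_length_eq card_Diff_subset finite_subset of_nat_diff g_def
        power_divide [symmetric] diff_divide_distrib)
  also have "\<dots> \<le> exp (- g) ^ m"
    using g exp_ge_add_one_self[of "- g"] by (intro power_mono) auto
  also have "\<dots> = exp (- (real m * g))"
    by (simp add: exp_of_nat_mult [symmetric])
  also have "\<dots> \<le> exp (- y)"
    using assms(5) by (simp add: g_def)
  also have "\<dots> \<le> 1 / (1 + y)"
    using exp_ge_add_one_self[of y] assms(4)
    by (simp add: exp_minus inverse_eq_divide frac_le)
  finally have "1 - 1 / (1 + y) \<le>
      measure_pmf.prob (pmf_of_set (?X S)) {xs. set xs \<inter> G \<noteq> {}}"
    using measure_pmf.prob_compl[of "{xs. set xs \<inter> G \<noteq> {}}" "pmf_of_set (?X S)"]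
    by (simp add: Compl_eq_Diff_UNIV)
  moreover have "1 - 1 / (1 + y) = y / (1 + y)"
    using assms(4) by (simp add: field_simps)
  ultimately show ?thesis by simp
qed

section \<open>Ranks, nearest neighbours and rank disorder\<close>

text \<open>The counting function is strictly increasing in \<open>f\<close>, hence injective as
  \<open>f\<close> is; an injective image inside \<open>{1..card T}\<close> of the same size is all
  of it.\<close>

lemma bij_betw_card_le:
  fixes f :: "'a \<Rightarrow> real"
  assumes "finite T" "inj_on f T"
  shows "bij_betw (\<lambda>x. card {w \<in> T. f w \<le> f x}) T {1..card T}"
proof -
  let ?r = "\<lambda>x. card {w \<in> T. f w \<le> f x}"
  have less: "?r x < ?r y" if "f x < f y" "y \<in> T" for x y
  proof (rule psubset_card_mono)
    have "y \<in> {w \<in> T. f w \<le> f y} - {w \<in> T. f w \<le> f x}" using that by simp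
    then show "{w \<in> T. f w \<le> f x} \<subset> {w \<in> T. f w \<le> f y}" using that by force
  qed (use assms in simp)
  have inj: "inj_on ?r T"
  proof (rule inj_onI)
    fix x y assume "x \<in> T" "y \<in> T" "?r x = ?r y"
    then have "f x = f y" using less[of x y] less[of y x] by (cases "f x" "f y" rule: linorder_cases) auto
    then show "x = y" using assms \<open>x \<in> T\<close> \<open>y \<in> T\<close> by (auto dest: inj_onD)
  qed
  have "?r ` T \<subseteq> {1..card T}"
    using assms(1) by (auto intro!: card_mono simp: Suc_le_eq card_gt_0_iff)
  moreover have "card (?r ` T) = card {1..card T}"
    using inj by (simp add: card_image)
  ultimately have "?r ` T = {1..card T}"
    by (intro card_subset_eq) auto
  with inj show ?thesis by (simp add: bij_betw_def)
qed

text \<open>\<open>distinct_distances\<close> speaks only of pairs of distinct objects, so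
  \<open>q \<notin> T\<close> keeps the unconstrained \<open>d q q\<close> out of the
  comparison.\<close>

lemma inj_on_distance:
  assumes "distinct_distances K d" "T \<subseteq> K" "q \<in> K" "q \<notin> T"
  shows "inj_on (\<lambda>x. d x q) T"
proof (rule inj_onI, rule ccontr)
  fix x y assume xy: "x \<in> T" "y \<in> T" "d x q = d y q" "x \<noteq> y"
  then have "x \<in> K" "y \<in> K" "x \<noteq> q" "y \<noteq> q" "{x, q} \<noteq> {y, q}"
    using assms by (auto simp: doubleton_eq_iff)
  then show False
    using assms(1,3) xy(3) unfolding distinct_distances_def by blast
qed

lemma card_rank:
  assumes "distinct_distances K d" "T \<subseteq> K" "q \<in> K" "q \<notin> T" "finite T"
  shows "card {x \<in> T. P (rank d q x T)} = card {i \<in> {1..card T}. P i}"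
proof -
  have "bij_betw (\<lambda>x. rank d q x T) T {1..card T}"
    using bij_betw_card_le[OF assms(5) inj_on_distance[OF assms(1-4)]] assms(4)
    by (subst bij_betw_cong[where g = "\<lambda>x. card {w \<in> T. d w q \<le> d x q}"]) (auto simp: rank_def)
  then have "inj_on (\<lambda>x. rank d q x T) T" and im: "(\<lambda>x. rank d q x T) ` T = {1..card T}"
    by (auto simp: bij_betw_def)
  then have "card {x \<in> T. P (rank d q x T)} = card ((\<lambda>x. rank d q x T) ` {x \<in> T. P (rank d q x T)})"
    by (intro card_image [symmetric]) (auto elim: inj_on_subset)
  also have "(\<lambda>x. rank d q x T) ` {x \<in> T. P (rank d q x T)} = {i \<in> {1..card T}. P i}"
    unfolding im [symmetric] by auto
  finally show ?thesis .
qed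

lemma rank_pos: "finite S \<Longrightarrow> u \<in> S \<Longrightarrow> u \<noteq> v \<Longrightarrow> 1 \<le> rank d v u S"
  by (auto simp: rank_def Suc_le_eq card_gt_0_iff)

lemma rank_le_card: "finite S \<Longrightarrow> rank d v u S \<le> card S"
  by (auto simp: rank_def intro!: card_mono)

lemma rank_self [simp]: "rank d v v S = 0"
  by (simp add: rank_def)

lemma rank_mono_set: "finite S' \<Longrightarrow> S \<subseteq> S' \<Longrightarrow> rank d v u S \<le> rank d v u S'"
  by (auto simp: rank_def intro!: card_mono)

text \<open>Lets ranks around the query pass freely between \<open>T\<close> and
  \<open>insert q T\<close>, the set whose disorder is used.\<close>

lemma rank_insert_self [simp]: "rank d v u (insert v S) = rank d v u S"
  by (simp add: rank_def)

lemma rank_mono_distance: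
  assumes "finite S" "u \<noteq> v" "u' \<noteq> v" "d u v \<le> d u' v"
  shows "rank d v u S \<le> rank d v u' S"
  using assms by (auto simp: rank_def intro!: card_mono)

text \<open>Ranks run bijectively through \<open>1..n\<close>, so an object of rank \<open>r\<close>
  is preceded by exactly \<open>r - 1\<close> objects, which is less than \<open>R\<close> iff
  \<open>r \<le> R\<close>.\<close>

lemma nearest_neighbors_eq:
  assumes "distinct_distances K d" "T \<subseteq> K" "q \<in> K" "q \<notin> T" "finite T"
  shows "nearest_neighbors d R q T = {u \<in> T. rank d q u T \<le> R}"
proof -
  have "card {w \<in> T. rank d q w T < rank d q u T} < R \<longleftrightarrow> rank d q u T \<le> R" if "u \<in> T" for u
  proof -
    have r: "1 \<le> rank d q u T" "rank d q u T \<le> card T"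
      using that assms rank_pos[of T u q d] rank_le_card[of T d q u] by auto
    have "{i \<in> {1..card T}. i < rank d q u T} = {1..<rank d q u T}"
      using r by auto
    then have "card {w \<in> T. rank d q w T < rank d q u T} = rank d q u T - 1"
      using card_rank[OF assms, of "\<lambda>i. i < rank d q u T"] by simp
    then show ?thesis using r by linarith
  qed
  then show ?thesis unfolding nearest_neighbors_def by blast
qed

text \<open>\<open>LEAST\<close> over the reals has meaning only if the minimum is attained. The
  admissible constants form a closed set that is bounded below by 0 and contains
  \<open>card S\<close>, so their infimum is admissible.\<close>

lemma rank_disorder_properties:
  assumes "finite S"
  shows "0 \<le> rank_disorder d S"
    and "\<And>x y z. x \<in> S \<Longrightarrow> y \<in> S \<Longrightarrow> z \<in> S \<Longrightarrow>
      real (rank d x y S) \<le> rank_disorder d S * (real (rank d z x S) + real (rank d z y S))"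
    and "\<And>x y z. x \<in> S \<Longrightarrow> y \<in> S \<Longrightarrow> z \<in> S \<Longrightarrow>
      real (rank d x y S) \<le> rank_disorder d S * (real (rank d x z S) + real (rank d z y S))"
proof -
  define P where "P D \<longleftrightarrow> 0 \<le> D \<and>
     (\<forall>x\<in>S. \<forall>y\<in>S. \<forall>z\<in>S.
        real (rank d x y S) \<le> D * (real (rank d z x S) + real (rank d z y S)) \<and>
        real (rank d x y S) \<le> D * (real (rank d x z S) + real (rank d y z S)) \<and>
        real (rank d x y S) \<le> D * (real (rank d x z S) + real (rank d z y S)) \<and>
        real (rank d x y S) \<le> D * (real (rank d z x S) + real (rank d y z S)))" for D :: real
  have "closed {D. P D}"
    unfolding P_def Ball_def
    by (intro closed_Collect_conj closed_Collect_all closed_Collect_imp closed_Collect_le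
        continuous_intros) auto
  moreover have "P (real (card S))"
  proof -
    \<comment> \<open>If \<open>x \<noteq> y\<close>, then \<open>z\<close> differs from one of
      them, so one of the two ranks on each right-hand side is at least 1, while the left-hand side
      is at most \<open>card S\<close>.\<close>
    have *: "real (rank d x y S) \<le> real (card S) * (real i + real j)"
      if "x = y \<or> 1 \<le> i \<or> 1 \<le> j" for x y and i j :: nat
    proof (cases "x = y")
      case False
      then have "1 \<le> real i + real j" using that by linarith
      then have "real (card S) * 1 \<le> real (card S) * (real i + real j)"
        by (intro mult_left_mono) auto
      then show ?thesis using rank_le_card[OF assms, of d x y] by linarith
    qed simp
    show ?thesis
      unfolding P_def by (intro conjI ballI * of_nat_0_le_iff) (use rank_pos[OF assms] in metis)+
  qed
  moreover have bdd: "bdd_below {D. P D}"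
    by (rule bdd_belowI[of _ 0]) (simp add: P_def)
  ultimately have "P (Inf {D. P D})"
    using closed_contains_Inf[of "{D. P D}"] by blast
  moreover from this have "rank_disorder d S = Inf {D. P D}"
    unfolding rank_disorder_def P_def [symmetric]
    by (rule Least_equality) (use bdd in \<open>auto intro: cInf_lower\<close>)
  ultimately have P: "P (rank_disorder d S)" by simp
  then show "0 \<le> rank_disorder d S"
    by (simp add: P_def)
  fix x y z assume "x \<in> S" "y \<in> S" "z \<in> S"
  then show "real (rank d x y S) \<le> rank_disorder d S * (real (rank d z x S) + real (rank d z y S))"
    and "real (rank d x y S) \<le> rank_disorder d S * (real (rank d x z S) + real (rank d z y S))"
    using P unfolding P_def by blast+
qed

text \<open>With \<open>z = y\<close>, the inequality through \<open>r_x(z) + r_z(y)\<close> becomes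
  \<open>r_x(y) \<le> D r_x(y)\<close> with a positive rank. The bound later lets rounding errors be
  absorbed into \<open>D\<close> and \<open>D\<close> be replaced by its square.\<close>

lemma rank_disorder_ge_1:
  assumes "finite S" "x \<in> S" "y \<in> S" "x \<noteq> y"
  shows "1 \<le> rank_disorder d S"
proof -
  have "1 \<le> rank d x y S" using assms by (intro rank_pos) auto
  moreover have "real (rank d x y S) \<le> rank_disorder d S * real (rank d x y S)"
    using rank_disorder_properties(3)[OF assms(1,2,3,3), of d] by simp
  ultimately show ?thesis by simp
qed

section \<open>Merge sort with oracle comparisons\<close>

fun merge_alg :: "'k \<Rightarrow> 'k list \<Rightarrow> 'k list \<Rightarrow> ('k, 'k list) alg" where
  "merge_alg s [] ys = Return ys"
| "merge_alg s xs [] = Return xs"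
| "merge_alg s (x # xs) (y # ys) = Ask s x y (\<lambda>a.
     if a = x then bind_alg (merge_alg s xs (y # ys)) (\<lambda>l. Return (x # l))
     else bind_alg (merge_alg s (x # xs) ys) (\<lambda>l. Return (y # l)))"

text \<open>Each question settles one element of the output, which bounds the count by the total
  length. The element moved is at most as far from \<open>s\<close> as both heads, hence as
  everything still to be merged.\<close>

lemma run_merge_alg:
  assumes "sorted_wrt (\<lambda>u v. d u s \<le> d v s) xs" "sorted_wrt (\<lambda>u v. d u s \<le> d v s) ys"
  shows "\<exists>l c. run (comparison_oracle d) (merge_alg s xs ys) = return_pmf (l, c) \<and>
    mset l = mset xs + mset ys \<and> sorted_wrt (\<lambda>u v. d u s \<le> d v s) l \<and>
    c \<le> length xs + length ys"
  using assms
proof (induction s xs ys rule: merge_alg.induct)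
  case (3 s x xs y ys)
  show ?case
  proof (cases "comparison_oracle d s x y = x")
    case True
    then have le: "d x s \<le> d y s"
      by (auto simp: comparison_oracle_def split: if_splits)
    obtain l c where l: "run (comparison_oracle d) (merge_alg s xs (y # ys)) = return_pmf (l, c)"
      "mset l = mset xs + mset (y # ys)" "sorted_wrt (\<lambda>u v. d u s \<le> d v s) l"
      "c \<le> length xs + length (y # ys)"
      using "3.IH"(1)[OF True] "3.prems" by auto
    have "set l = set xs \<union> set (y # ys)"
      using arg_cong[OF l(2), of set_mset] by simp
    then have "sorted_wrt (\<lambda>u v. d u s \<le> d v s) (x # l)"
      using l(3) le "3.prems" by (auto intro: order_trans)
    then show ?thesis
      using l(2,4) True by (intro exI[of _ "x # l"] exI[of _ "Suc c"])
        (simp add: run_bind_alg_return[OF l(1)])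
  next
    case False
    then have le: "d y s \<le> d x s"
      by (auto simp: comparison_oracle_def split: if_splits)
    obtain l c where l: "run (comparison_oracle d) (merge_alg s (x # xs) ys) = return_pmf (l, c)"
      "mset l = mset (x # xs) + mset ys" "sorted_wrt (\<lambda>u v. d u s \<le> d v s) l"
      "c \<le> length (x # xs) + length ys"
      using "3.IH"(2)[OF False] "3.prems" by auto
    have "set l = set (x # xs) \<union> set ys"
      using arg_cong[OF l(2), of set_mset] by simp
    then have "sorted_wrt (\<lambda>u v. d u s \<le> d v s) (y # l)"
      using l(3) le "3.prems" by (auto intro: order_trans)
    then show ?thesis
      using l(2,4) False by (intro exI[of _ "y # l"] exI[of _ "Suc c"])
        (simp add: run_bind_alg_return[OF l(1)])
  qed
qed auto

text \<open>The first argument bounds the recursion depth; lists of length up to \<open>2 ^ h\<close> get sorted.\<close>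

primrec sort_alg :: "nat \<Rightarrow> 'k \<Rightarrow> 'k list \<Rightarrow> ('k, 'k list) alg" where
  "sort_alg 0 s xs = Return xs"
| "sort_alg (Suc h) s xs =
     bind_alg (sort_alg h s (take (2 ^ h) xs)) (\<lambda>us.
     bind_alg (sort_alg h s (drop (2 ^ h) xs)) (\<lambda>vs. merge_alg s us vs))"

text \<open>Each of the \<open>h\<close> levels merges lists of total length
  \<open>length xs\<close>, with at most one question per element. At depth 0 a list has at most one
  element and is already sorted.\<close>

lemma run_sort_alg:
  assumes "length xs \<le> 2 ^ h"
  shows "\<exists>l c. run (comparison_oracle d) (sort_alg h s xs) = return_pmf (l, c) \<and>
    mset l = mset xs \<and> sorted_wrt (\<lambda>u v. d u s \<le> d v s) l \<and> c \<le> h * length xs"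
  using assms
proof (induction h arbitrary: xs)
  case 0
  then show ?case by (cases xs) auto
next
  case (Suc h)
  obtain us b where us: "run (comparison_oracle d) (sort_alg h s (take (2 ^ h) xs)) = return_pmf (us, b)"
    "mset us = mset (take (2 ^ h) xs)" "sorted_wrt (\<lambda>u v. d u s \<le> d v s) us"
    "b \<le> h * length (take (2 ^ h) xs)"
    using Suc.IH[of "take (2 ^ h) xs"] by auto
  obtain vs c where vs: "run (comparison_oracle d) (sort_alg h s (drop (2 ^ h) xs)) = return_pmf (vs, c)"
    "mset vs = mset (drop (2 ^ h) xs)" "sorted_wrt (\<lambda>u v. d u s \<le> d v s) vs"
    "c \<le> h * length (drop (2 ^ h) xs)"
    using Suc.IH[of "drop (2 ^ h) xs"] Suc.prems by (auto simp: le_diff_conv)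
  obtain l e where l: "run (comparison_oracle d) (merge_alg s us vs) = return_pmf (l, e)"
    "mset l = mset us + mset vs" "sorted_wrt (\<lambda>u v. d u s \<le> d v s) l"
    "e \<le> length us + length vs"
    using run_merge_alg[of d s us vs] us(3) vs(3) by auto
  have len: "length (take (2 ^ h) xs) + length (drop (2 ^ h) xs) = length xs"
    by (metis append_take_drop_id length_append)
  have "length us + length vs = length xs"
    using len us(2) vs(2) by (metis size_mset)
  moreover have "b + c \<le> h * length xs"
    using us(4) vs(4) unfolding len [symmetric] distrib_left by linarith
  ultimately have "b + (c + e) \<le> Suc h * length xs"
    using l(4) by simp
  moreover have "mset l = mset xs"
    using l(2) us(2) vs(2) by (metis append_take_drop_id mset_append)
  moreover have "run (comparison_oracle d) (sort_alg (Suc h) s xs) = return_pmf (l, b + (c + e))"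
    by (simp add: run_bind_alg_return[OF us(1)] run_bind_alg_return[OF vs(1)] l(1))
  ultimately show ?case using l(3) by blast
qed

section \<open>Learning phase\<close>

text \<open>Without ties, the objects at most as far from \<open>s\<close> as \<open>l ! i\<close>
  are the first \<open>i + 1\<close> entries of \<open>l\<close>, so \<open>l ! i\<close> has rank
  \<open>i + 1\<close>. Prepending \<open>s\<close>, of rank 0, makes positions and ranks
  agree.\<close>

lemma is_ranking_sorted:
  assumes "distinct_distances K d" "T \<subseteq> K" "finite T" "s \<in> T"
    and "set l = T - {s}" "distinct l" "sorted_wrt (\<lambda>u v. d u s \<le> d v s) l"
  shows "is_ranking d s T (s # l)"
proof -
  have inj: "inj_on (\<lambda>x. d x s) (T - {s})"
    using assms by (intro inj_on_distance[where K = K]) auto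
  have "rank d s (l ! i) T = Suc i" if i: "i < length l" for i
  proof -
    have "l ! i \<in> T - {s}" using i assms(5) nth_mem by blast
    have "{w \<in> T - {s}. d w s \<le> d (l ! i) s} = set (take (Suc i) l)"
    proof (intro equalityI subsetI)
      fix w assume "w \<in> {w \<in> T - {s}. d w s \<le> d (l ! i) s}"
      then have "w \<in> set l" and le: "d w s \<le> d (l ! i) s"
        using assms(5) by auto
      then obtain j where j: "j < length l" "w = l ! j"
        by (metis in_set_conv_nth)
      have "j \<le> i"
      proof (rule ccontr)
        assume "\<not> j \<le> i"
        then have "d (l ! i) s \<le> d (l ! j) s"
          using j assms(7) by (auto simp: sorted_wrt_iff_nth_less)
        then have "d (l ! i) s = d (l ! j) s" using j le by simp
        then have "l ! i = l ! j"
          using inj i j assms(5) nth_mem by (metis (no_types, lifting) inj_onD)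
        then show False
          using \<open>\<not> j \<le> i\<close> i j assms(6) nth_eq_iff_index_eq by fastforce
      qed
      then show "w \<in> set (take (Suc i) l)"
        using j by (auto simp: in_set_conv_nth intro!: exI[of _ j])
    next
      fix w assume w: "w \<in> set (take (Suc i) l)"
      then obtain j where j: "j \<le> i" "w = l ! j"
        by (auto simp: in_set_conv_nth less_Suc_eq_le)
      then have "d w s \<le> d (l ! i) s"
        using i assms(7) by (cases "j = i") (auto simp: sorted_wrt_iff_nth_less)
      then show "w \<in> {w \<in> T - {s}. d w s \<le> d (l ! i) s}"
        using w assms(5) by (auto dest: in_set_takeD)
    qed
    moreover have "card (set (take (Suc i) l)) = Suc i"
      using assms(6) i by (subst distinct_card) auto
    ultimately show ?thesis
      using \<open>l ! i \<in> T - {s}\<close> by (simp add: rank_def)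
  qed
  then have "rank d s ((s # l) ! i) T = i" if "i < length (s # l)" for i
    using that by (cases i) auto
  moreover have "set (s # l) = T"
    using assms by auto
  moreover have "length (s # l) = card T"
    using assms distinct_card[OF assms(6)] card_Suc_Diff1[OF assms(3,4)] by simp
  ultimately show ?thesis
    unfolding is_ranking_def by blast
qed

definition enum_set :: "'k set \<Rightarrow> 'k list" where
  "enum_set A = (SOME l. set l = A \<and> distinct l)"

lemma enum_set:
  assumes "finite A"
  shows "set (enum_set A) = A" "distinct (enum_set A)"
  using someI_ex[OF finite_distinct_list[OF assms]] unfolding enum_set_def by blast+

text \<open>\<open>s\<close> is left out of the sorting and put in front, since nothing is known
  about \<open>d s s\<close> and sorting might misplace it. The depth is the least \<open>h\<close>
  with \<open>n \<le> 2 ^ h\<close>.\<close>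

primrec rank_all :: "'k set \<Rightarrow> 'k list \<Rightarrow> ('k, ('k \<times> 'k list) list) alg" where
  "rank_all T [] = Return []"
| "rank_all T (s # ss) =
     bind_alg (sort_alg (nat \<lceil>log 2 (real (card T))\<rceil>) s (enum_set (T - {s}))) (\<lambda>l.
     bind_alg (rank_all T ss) (\<lambda>L. Return ((s, s # l) # L)))"

lemma run_rank_all:
  assumes "distinct_distances K d" "T \<subseteq> K" "finite T" "set ss \<subseteq> T"
  shows "\<exists>L c. run (comparison_oracle d) (rank_all T ss) = return_pmf (L, c) \<and>
    map fst L = ss \<and> (\<forall>(s, l) \<in> set L. is_ranking d s T l) \<and>
    real c \<le> 2 * (real (card T) * real (length ss) * log 2 (real (card T)))"
  using assms(4)
proof (induction ss)
  case (Cons s ss)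
  let ?n = "card T" and ?h = "nat \<lceil>log 2 (real (card T))\<rceil>"
  have s: "s \<in> T" using Cons.prems by simp
  then have n: "1 \<le> ?n" using assms(3) by (auto simp: Suc_le_eq card_gt_0_iff)
  have len: "length (enum_set (T - {s})) = ?n - 1"
    using enum_set[of "T - {s}"] assms(3) s by (metis card_Diff_singleton distinct_card finite_Diff)
  have "real ?n = 2 powr log 2 (real ?n)" using n by simp
  also have "\<dots> \<le> 2 powr real ?h"
    by (intro powr_mono) linarith+
  finally have "real ?n \<le> real (2 ^ ?h)" by (simp add: powr_realpow)
  then have h: "?n \<le> 2 ^ ?h" by (simp only: of_nat_le_iff)
  obtain l b where l: "run (comparison_oracle d) (sort_alg ?h s (enum_set (T - {s}))) = return_pmf (l, b)"
    "mset l = mset (enum_set (T - {s}))" "sorted_wrt (\<lambda>u v. d u s \<le> d v s) l"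
    "b \<le> ?h * (?n - 1)"
    using run_sort_alg[of "enum_set (T - {s})" ?h d s] le_trans[OF diff_le_self h]
    unfolding len by blast
  obtain L c where L: "run (comparison_oracle d) (rank_all T ss) = return_pmf (L, c)"
    "map fst L = ss" "\<forall>(s, l) \<in> set L. is_ranking d s T l"
    "real c \<le> 2 * (real ?n * real (length ss) * log 2 (real ?n))"
    using Cons by auto
  have "set l = T - {s}" "distinct l"
    using enum_set[of "T - {s}"] assms(3) l(2) mset_eq_setD mset_eq_imp_distinct_iff
    by (blast, metis finite_Diff)
  then have "is_ranking d s T (s # l)"
    using is_ranking_sorted[OF assms(1-3) s] l(3) by blast
  \<comment> \<open>The factor 2 pays for rounding the depth up: for \<open>n \<ge> 2\<close> the
    logarithm is at least 1, so its ceiling is at most twice as large. For \<open>n = 1\<close> the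
    list to sort is empty and no question is asked.\<close>
  moreover have "real b \<le> 2 * (real ?n * log 2 (real ?n))"
  proof (cases "?n = 1")
    case True
    then show ?thesis using l(4) by simp
  next
    case False
    with n have n2: "2 \<le> ?n" by simp
    then have "1 \<le> log 2 (real ?n)" by (simp add: le_log_iff)
    then have "real ?h \<le> 2 * log 2 (real ?n)" by linarith
    then have "real ?n * real ?h \<le> real ?n * (2 * log 2 (real ?n))"
      by (intro mult_left_mono) auto
    moreover have "b \<le> ?n * ?h"
      using l(4) by (metis diff_le_self mult.commute mult_le_mono1 order_trans)
    then have "real b \<le> real ?n * real ?h"
      by (metis of_nat_le_iff of_nat_mult)
    ultimately show ?thesis by simp
  qed
  then have "real (b + c) \<le> 2 * (real ?n * real (length (s # ss)) * log 2 (real ?n))"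
    using L(4) by (simp add: algebra_simps)
  ultimately show ?case
    using L(2,3) by (intro exI[of _ "(s, s # l) # L"] exI[of _ "b + c"])
      (simp add: run_bind_alg_return[OF l(1)] run_bind_alg_return[OF L(1)])
qed auto

text \<open>Lists rather than subsets model independent draws with replacement, so \<open>m\<close>
  may exceed the size of \<open>T\<close>.\<close>

definition learn_alg :: "'k set \<Rightarrow> nat \<Rightarrow> ('k, ('k \<times> 'k list) list) alg" where
  "learn_alg T m = Random (map_pmf (rank_all T) (pmf_of_set {xs. set xs \<subseteq> T \<and> length xs = m}))"

text \<open>Once the sample is drawn, ranking is deterministic, so result and question count are
  functions \<open>L\<close> and \<open>c\<close> of the sample.\<close>

lemma run_learn_alg:
  assumes "distinct_distances K d" "T \<subseteq> K" "finite T" "T \<noteq> {}"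
  obtains L c where
    "run (comparison_oracle d) (learn_alg T m) =
       map_pmf (\<lambda>xs. (L xs, c xs)) (pmf_of_set {xs. set xs \<subseteq> T \<and> length xs = m})"
    and "\<And>xs. set xs \<subseteq> T \<Longrightarrow> map fst (L xs) = xs \<and> (\<forall>(s, l) \<in> set (L xs). is_ranking d s T l) \<and>
       real (c xs) \<le> 2 * (real (card T) * real (length xs) * log 2 (real (card T)))"
proof -
  have "\<forall>xs. \<exists>Lc. set xs \<subseteq> T \<longrightarrow>
    run (comparison_oracle d) (rank_all T xs) = return_pmf (fst Lc, snd Lc) \<and>
    map fst (fst Lc) = xs \<and> (\<forall>(s, l) \<in> set (fst Lc). is_ranking d s T l) \<and>
    real (snd Lc) \<le> 2 * (real (card T) * real (length xs) * log 2 (real (card T)))"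
    using run_rank_all[OF assms(1-3)] by (metis fst_conv snd_conv)
  then obtain F where F: "\<And>xs. set xs \<subseteq> T \<Longrightarrow>
    run (comparison_oracle d) (rank_all T xs) = return_pmf (fst (F xs), snd (F xs)) \<and>
    map fst (fst (F xs)) = xs \<and> (\<forall>(s, l) \<in> set (fst (F xs)). is_ranking d s T l) \<and>
    real (snd (F xs)) \<le> 2 * (real (card T) * real (length xs) * log 2 (real (card T)))"
    by metis
  have "run (comparison_oracle d) (learn_alg T m) =
      bind_pmf (pmf_of_set {xs. set xs \<subseteq> T \<and> length xs = m})
        (\<lambda>xs. return_pmf (fst (F xs), snd (F xs)))"
    unfolding learn_alg_def run_Random_map
    using F by (intro bind_pmf_cong refl) (auto simp: set_pmf_uniform_lists[OF assms(3,4)])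
  then show thesis
    using F by (intro that[of "\<lambda>xs. fst (F xs)" "\<lambda>xs. snd (F xs)"]) (auto simp: map_pmf_def)
qed

section \<open>Search phase\<close>

text \<open>The key \<open>f\<close> lets items carry data through the comparisons:
  \<open>fst\<close> keeps each sample together with its ranking, \<open>id\<close> serves for plain
  objects. \<open>x\<close> is the best item so far.\<close>

primrec closest_alg :: "'k \<Rightarrow> ('b \<Rightarrow> 'k) \<Rightarrow> 'b \<Rightarrow> 'b list \<Rightarrow> ('k, 'b) alg" where
  "closest_alg q f x [] = Return x"
| "closest_alg q f x (y # ys) =
     Ask q (f x) (f y) (\<lambda>a. closest_alg q f (if a = f x then x else y) ys)"

lemma run_closest_alg:
  "\<exists>z \<in> set (x # ys). run (comparison_oracle d) (closest_alg q f x ys) = return_pmf (z, length ys) \<and>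
     (\<forall>w \<in> set (x # ys). d (f z) q \<le> d (f w) q)"
proof (induction ys arbitrary: x)
  case (Cons y ys)
  let ?x = "if comparison_oracle d q (f x) (f y) = f x then x else y"
  have x: "d (f ?x) q \<le> d (f x) q" "d (f ?x) q \<le> d (f y) q" "?x = x \<or> ?x = y"
    by (auto simp: comparison_oracle_def)
  obtain z where "z \<in> set (?x # ys)"
    "run (comparison_oracle d) (closest_alg q f ?x ys) = return_pmf (z, length ys)"
    "\<forall>w \<in> set (?x # ys). d (f z) q \<le> d (f w) q"
    using Cons.IH by blast
  then show ?case
    using x by (intro bexI[of _ z]) (auto intro: order_trans)
qed simp

text \<open>With \<open>t = \<lceil>n / m\<rceil>\<close>, the number \<open>D (t + R)\<close>
  bounds the rank of each of the \<open>R\<close> nearest neighbours around a good sample. The extra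
  1 accounts for position 0, held by the sample itself.\<close>

definition candidates :: "nat \<Rightarrow> nat \<Rightarrow> nat \<Rightarrow> real \<Rightarrow> nat" where
  "candidates n m R D = nat \<lfloor>D * (real (nat \<lceil>real n / real m\<rceil>) + real R)\<rfloor> + 1"

text \<open>Up to a constant factor, the number of candidates divided by \<open>R\<close>, so that
  the expected number of neighbours among the draws is bounded below.\<close>

definition draws :: "nat \<Rightarrow> nat \<Rightarrow> nat \<Rightarrow> real \<Rightarrow> nat" where
  "draws n m R D = nat \<lceil>D + D * real n / (real m * real R)\<rceil>"

text \<open>A query inside \<open>T\<close> has rank 0 with respect to itself and is returned at no
  cost. The disorder \<open>D\<close> is an input because it fixes the length of the segment and the
  number of draws.\<close>

definition search_alg ::
  "'k set \<Rightarrow> nat \<Rightarrow> nat \<Rightarrow> real \<Rightarrow> ('k \<times> 'k list) list \<Rightarrow> 'k \<Rightarrow> ('k, 'k) alg" where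
  "search_alg T m R D L q =
     (if q \<in> T then Return q
      else bind_alg (closest_alg q fst (hd L) (tl L)) (\<lambda>(s, l).
        Random (map_pmf (\<lambda>ys. closest_alg q id (hd ys) (tl ys))
          (pmf_of_set {ys. set ys \<subseteq> set (take (candidates (card T) m R D) l) \<and>
             length ys = draws (card T) m R D}))))"

text \<open>The ceiling of \<open>n / m\<close> and the final 1 together cost at most
  \<open>D + 1 \<le> 2 D R\<close>. So the segment has at most \<open>3 R\<close> times as many
  entries as the unrounded number of draws, which yields the hit ratio \<open>1/3\<close>.\<close>

lemma candidates_le:
  assumes "1 \<le> D" "1 \<le> m" "1 \<le> R"
  shows "real (candidates n m R D) \<le> 3 * real R * (D + D * real n / (real m * real R))"
proof -
  have "0 \<le> D * (real (nat \<lceil>real n / real m\<rceil>) + real R)"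
    using assms by (intro mult_nonneg_nonneg add_nonneg_nonneg of_nat_0_le_iff) simp
  then have "real (candidates n m R D) \<le> D * (real (nat \<lceil>real n / real m\<rceil>) + real R) + 1"
    unfolding candidates_def by linarith
  also have "D * (real (nat \<lceil>real n / real m\<rceil>) + real R) \<le> D * ((real n / real m + 1) + real R)"
  proof (intro mult_left_mono add_right_mono)
    have "0 \<le> real n / real m" by simp
    then show "real (nat \<lceil>real n / real m\<rceil>) \<le> real n / real m + 1" by linarith
  qed (use assms in simp)
  also have "D * ((real n / real m + 1) + real R) + 1 \<le> D * (real n / real m) + 3 * (D * real R)"
  proof -
    have "D * 1 \<le> D * real R" using assms by (intro mult_left_mono) auto
    then have "D + 1 \<le> 2 * (D * real R)" using assms by linarith
    then show ?thesis using assms by (simp add: algebra_simps)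
  qed
  also have "\<dots> \<le> 3 * (D * (real n / real m)) + 3 * (D * real R)"
  proof -
    have "0 \<le> D * (real n / real m)" using assms by simp
    then show ?thesis by linarith
  qed
  also have "\<dots> = 3 * real R * (D + D * real n / (real m * real R))"
    using assms by (simp add: field_simps)
  finally show ?thesis by simp
qed

lemma draws_bounds:
  assumes "1 \<le> D"
  shows "1 \<le> draws n m R D" "D + D * real n / (real m * real R) \<le> real (draws n m R D)"
    "real (draws n m R D) \<le> D + D * real n / (real m * real R) + 1"
proof -
  have "0 \<le> D * real n / (real m * real R)" using assms by simp
  then show "1 \<le> draws n m R D" "D + D * real n / (real m * real R) \<le> real (draws n m R D)"
    "real (draws n m R D) \<le> D + D * real n / (real m * real R) + 1"
    using assms unfolding draws_def by linarith+
qed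

text \<open>With \<open>q\<close> as intermediate object,
  \<open>r_s(x) \<le> D (r_q(s) + r_q(x)) \<le> D (t + R)\<close>, and a ranking holds each object
  at the position given by its rank.\<close>

lemma nearest_neighbors_are_candidates:
  assumes "distinct_distances K d" "T \<subseteq> K" "q \<in> K" "q \<notin> T" "finite T" "s \<in> T"
    and "is_ranking d s T l"
    and "rank d q s T \<le> nat \<lceil>real (card T) / real m\<rceil>"
  shows "nearest_neighbors d R q T \<subseteq>
    set (take (candidates (card T) m R (rank_disorder d (insert q T))) l)"
proof
  let ?D = "rank_disorder d (insert q T)" and ?t = "nat \<lceil>real (card T) / real m\<rceil>"
  fix x assume "x \<in> nearest_neighbors d R q T"
  then have x: "x \<in> T" "rank d q x T \<le> R"
    using nearest_neighbors_eq[OF assms(1-5)] by auto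
  have fin: "finite (insert q T)" using assms by simp
  \<comment> \<open>The disorder is taken in \<open>insert q T\<close>, the stored ranking in
    \<open>T\<close>; adding \<open>q\<close> can only increase ranks around
    \<open>s\<close>.\<close>
  have "real (rank d s x T) \<le> real (rank d s x (insert q T))"
    using fin by (intro of_nat_mono rank_mono_set) auto
  also have "\<dots> \<le> ?D * (real (rank d q s T) + real (rank d q x T))"
    using rank_disorder_properties(2)[OF fin, of s x q d] x assms(6) by simp
  also have "\<dots> \<le> ?D * (real ?t + real R)"
    using x assms(8) rank_disorder_properties(1)[OF fin, of d]
    by (intro mult_left_mono add_mono of_nat_mono) auto
  finally have "rank d s x T < candidates (card T) m R ?D"
    unfolding candidates_def by linarith
  moreover obtain i where "i < length l" "x = l ! i"
    using x assms(7) by (auto simp: is_ranking_def in_set_conv_nth)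
  ultimately show "x \<in> set (take (candidates (card T) m R ?D) l)"
    using assms(7) by (auto simp: is_ranking_def in_set_conv_nth)
qed

text \<open>Whatever the random choices, the cost is \<open>m - 1\<close> questions for the samples
  plus one less than the number of draws. If some sample has rank at most \<open>t\<close>, so has
  the closest one, and all neighbours are candidates. Once a neighbour is drawn, the closest draw is
  at least as near and hence a neighbour itself.\<close>

lemma run_search_alg:
  assumes "distinct_distances K d" "T \<subseteq> K" "q \<in> K" "q \<notin> T" "finite T" "T \<noteq> {}"
    and "1 \<le> m" "1 \<le> R" "D = rank_disorder d (insert q T)"
    and "length L = m" "fst ` set L \<subseteq> T" "\<forall>(s, l) \<in> set L. is_ranking d s T l"
  shows "\<And>u c. (u, c) \<in> set_pmf (run (comparison_oracle d) (search_alg T m R D L q)) \<Longrightarrow>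
      real c \<le> real m + D + D * real (card T) / (real m * real R)"
    and "\<exists>s \<in> fst ` set L. rank d q s T \<le> nat \<lceil>real (card T) / real m\<rceil> \<Longrightarrow>
      1 / 4 \<le> measure_pmf.prob (run (comparison_oracle d) (search_alg T m R D L q))
        {(u, c). u \<in> nearest_neighbors d R q T}"
proof -
  let ?n = "card T" and ?N = "nearest_neighbors d R q T"
  let ?k = "draws (card T) m R D" and ?x = "D + D * real (card T) / (real m * real R)"
  have "L \<noteq> []" using assms(7,10) by auto
  then have L: "hd L # tl L = L" by simp
  obtain s l where sl: "(s, l) \<in> set L"
    "run (comparison_oracle d) (closest_alg q fst (hd L) (tl L)) = return_pmf ((s, l), m - 1)"
    and smin: "\<And>w. w \<in> fst ` set L \<Longrightarrow> d s q \<le> d w q"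
    using run_closest_alg[of "hd L" "tl L" d q fst] assms(10) unfolding L by fastforce
  have s: "s \<in> T" and rk: "is_ranking d s T l" using sl assms(11,12) by force+
  define C where "C = set (take (candidates ?n m R D) l)"
  define Y where "Y = {ys. set ys \<subseteq> C \<and> length ys = ?k}"
  have "s \<in> insert q T" "q \<in> insert q T" "s \<noteq> q" using s assms(4) by auto
  then have D: "1 \<le> D"
    using rank_disorder_ge_1[of "insert q T" s q d] assms(5,9) by simp
  have "l \<noteq> []" using rk s by (auto simp: is_ranking_def)
  then have C: "finite C" "C \<noteq> {}" "C \<subseteq> T" "card C \<le> candidates ?n m R D"
    using rk unfolding C_def
    by (auto simp: is_ranking_def candidates_def dest: in_set_takeD
        intro!: order_trans[OF card_length])
  have Y: "set_pmf (pmf_of_set Y) = Y"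
    unfolding Y_def by (rule set_pmf_uniform_lists[OF C(1,2)])
  have run: "run (comparison_oracle d) (search_alg T m R D L q) =
    bind_pmf (pmf_of_set Y) (\<lambda>ys. map_pmf (apsnd ((+) (m - 1)))
      (run (comparison_oracle d) (closest_alg q id (hd ys) (tl ys))))"
    using assms(4) unfolding search_alg_def
    by (simp add: run_bind_alg_return[OF sl(2)] run_Random_map C_def Y_def map_bind_pmf
        del: run.simps)
  have closest: "\<exists>z \<in> set ys. map_pmf (apsnd ((+) (m - 1)))
      (run (comparison_oracle d) (closest_alg q id (hd ys) (tl ys))) =
      return_pmf (z, m - 1 + (?k - 1)) \<and> (\<forall>w \<in> set ys. d z q \<le> d w q)" if "ys \<in> Y" for ys
  proof -
    have "length ys = ?k" using that by (simp add: Y_def)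
    moreover have "ys \<noteq> []" using calculation draws_bounds(1)[OF D, of ?n m R] by auto
    ultimately show ?thesis
      using run_closest_alg[of "hd ys" "tl ys" d q id] by auto
  qed
  show "real c \<le> real m + D + D * real ?n / (real m * real R)"
    if uc: "(u, c) \<in> set_pmf (run (comparison_oracle d) (search_alg T m R D L q))" for u c
  proof -
    from uc obtain ys where "ys \<in> Y" "(u, c) \<in> set_pmf (map_pmf (apsnd ((+) (m - 1)))
        (run (comparison_oracle d) (closest_alg q id (hd ys) (tl ys))))"
      unfolding run set_bind_pmf Y by blast
    then have "c = m - 1 + (?k - 1)"
      using closest[of ys] by (metis Pair_inject set_return_pmf singletonD)
    then show ?thesis
      using draws_bounds[OF D, of ?n m R] assms(7) by linarith
  qed
  assume "\<exists>s \<in> fst ` set L. rank d q s T \<le> nat \<lceil>real ?n / real m\<rceil>"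
  then obtain w where w: "w \<in> fst ` set L" "rank d q w T \<le> nat \<lceil>real ?n / real m\<rceil>" by blast
  have "w \<noteq> q" using w(1) assms(4,11) by blast
  then have "rank d q s T \<le> rank d q w T"
    using smin[OF w(1)] \<open>s \<noteq> q\<close> assms(5) by (intro rank_mono_distance) auto
  then have N: "?N \<subseteq> C"
    using nearest_neighbors_are_candidates[OF assms(1-5) s rk, of m R] w(2)
    unfolding C_def assms(9) by simp
  have NNeq: "?N = {u \<in> T. rank d q u T \<le> R}"
    by (rule nearest_neighbors_eq[OF assms(1-5)])
  have Cpos: "0 < card C" using C by (simp add: card_gt_0_iff)
  \<comment> \<open>The ratio is the expected number of draws that hit a neighbour.\<close>
  have ratio: "1 / 3 \<le> real ?k * real (card ?N) / real (card C)"
  proof (cases "R < ?n")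
    case True
    then have "{i \<in> {1..?n}. i \<le> R} = {1..R}" by auto
    then have "card ?N = R"
      using card_rank[OF assms(1-5), of "\<lambda>i. i \<le> R"] NNeq by simp
    moreover have "real (card C) \<le> 3 * real R * ?x"
      using C(4) candidates_le[OF D assms(7,8), of ?n] by linarith
    moreover have "3 * real R * ?x \<le> 3 * real R * real ?k"
      using draws_bounds(2)[OF D, of ?n m R] by (intro mult_left_mono) auto
    ultimately have "real (card C) \<le> 3 * (real ?k * real (card ?N))"
      by (simp only: mult_ac)
    then show ?thesis
      using Cpos by (simp add: field_simps)
  next
    \<comment> \<open>For \<open>R \<ge> n\<close> the neighbours are all of \<open>T\<close>, so
      every candidate is one and a single draw suffices.\<close>
    case False
    then have "rank d q u T \<le> R" for u
      using rank_le_card[OF assms(5), of d q u] by linarith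
    then have "?N = C" using N C(3) NNeq by auto
    then show ?thesis
      using Cpos draws_bounds(1)[OF D, of ?n m R] by simp
  qed
  have "(1 / 3) / (1 + 1 / 3) \<le> measure_pmf.prob (pmf_of_set Y) {ys. set ys \<inter> ?N \<noteq> {}}"
    unfolding Y_def by (rule prob_uniform_list_hits[OF C(1,2) N _ ratio]) simp
  \<comment> \<open>The second factor is 1: after a hit the remaining scan is deterministic and
    succeeds.\<close>
  then have "1 / 4 * 1 \<le> measure_pmf.prob (run (comparison_oracle d) (search_alg T m R D L q))
      {(u, c). u \<in> ?N}"
    unfolding run
  proof (intro prob_bind_pmf_ge)
    fix ys assume "ys \<in> set_pmf (pmf_of_set Y)" "ys \<in> {ys. set ys \<inter> ?N \<noteq> {}}"
    then obtain v where ys: "ys \<in> Y" "v \<in> set ys" "v \<in> ?N" using Y by auto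
    obtain z where z: "z \<in> set ys" "map_pmf (apsnd ((+) (m - 1)))
      (run (comparison_oracle d) (closest_alg q id (hd ys) (tl ys))) =
      return_pmf (z, m - 1 + (?k - 1))" "d z q \<le> d v q"
      using closest[OF ys(1)] ys(2) by blast
    have zT: "z \<in> T" using z(1) ys(1) C(3) by (auto simp: Y_def)
    have vT: "v \<in> T" "rank d q v T \<le> R" using ys(3) NNeq by auto
    have "rank d q z T \<le> rank d q v T"
      using zT vT assms(4,5) z(3) by (intro rank_mono_distance) auto
    then have "z \<in> ?N" using NNeq zT vT by simp
    then show "1 \<le> measure_pmf.prob (map_pmf (apsnd ((+) (m - 1)))
      (run (comparison_oracle d) (closest_alg q id (hd ys) (tl ys)))) {(u, c). u \<in> ?N}"
      unfolding z(2) by (simp add: measure_return_pmf)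
  qed auto
  then show "1 / 4 \<le> measure_pmf.prob (run (comparison_oracle d) (search_alg T m R D L q))
      {(u, c). u \<in> ?N}" by simp
qed

section \<open>Both phases together\<close>

text \<open>As \<open>t \<le> n\<close>, exactly \<open>t\<close> objects have rank at most
  \<open>t\<close>. The expected number of draws hitting them is \<open>m t / n \<ge> 1\<close>, and
  \<open>y = 1\<close> in the hitting bound gives \<open>1/2\<close>.\<close>

lemma prob_close_sample:
  assumes "distinct_distances K d" "T \<subseteq> K" "q \<in> K" "q \<notin> T" "finite T" "T \<noteq> {}" "1 \<le> m"
  shows "1 / 2 \<le> measure_pmf.prob (pmf_of_set {xs. set xs \<subseteq> T \<and> length xs = m})
    {xs. set xs \<inter> {x \<in> T. rank d q x T \<le> nat \<lceil>real (card T) / real m\<rceil>} \<noteq> {}}"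
proof -
  let ?n = "card T"
  define t where "t = nat \<lceil>real ?n / real m\<rceil>"
  have n: "0 < ?n" using assms by (simp add: card_gt_0_iff)
  have "real ?n / real m \<le> real ?n / 1"
    using assms(7) by (intro divide_left_mono) auto
  then have "t \<le> ?n" unfolding t_def by linarith
  then have "{i \<in> {1..?n}. i \<le> t} = {1..t}" by auto
  then have card: "card {x \<in> T. rank d q x T \<le> t} = t"
    using card_rank[OF assms(1-5), of "\<lambda>i. i \<le> t"] by simp
  have "real ?n / real m \<le> real t" unfolding t_def by linarith
  then have "1 \<le> real m * real t / real ?n"
    using assms(7) n by (simp add: field_simps)
  then have "1 / (1 + 1) \<le> measure_pmf.prob (pmf_of_set {xs. set xs \<subseteq> T \<and> length xs = m})
      {xs. set xs \<inter> {x \<in> T. rank d q x T \<le> t} \<noteq> {}}"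
    using assms card by (intro prob_uniform_list_hits) auto
  then show ?thesis unfolding t_def by simp
qed

text \<open>A close sample occurs with probability at least \<open>1/2\<close>, and the draws then
  succeed with probability at least \<open>1/4\<close>. Forming \<open>found\<close> discards the
  counter of the learning phase, so only search questions are counted.\<close>

lemma search_after_learn:
  assumes "distinct_distances K d" "T \<subseteq> K" "q \<in> K" "finite T" "T \<noteq> {}" "1 \<le> m" "1 \<le> R"
    and "D = rank_disorder d (insert q T)"
    and "found = bind_pmf (run (comparison_oracle d) (learn_alg T m))
      (\<lambda>(L, c). run (comparison_oracle d) (search_alg T m R D L q))"
  shows "1 / 8 \<le> measure_pmf.prob found {(u, c). u \<in> nearest_neighbors d R q T}"
    and "expected_questions found \<le>
      ennreal (real m + log 2 (real (card T)) + D + D\<^sup>2 * real (card T) / (real m * real R) + 1)"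
proof -
  let ?X = "{xs. set xs \<subseteq> T \<and> length xs = m}" and ?n = "card T"
  let ?A = "{(u, c :: nat). u \<in> nearest_neighbors d R q T}"
  have "1 / 8 \<le> measure_pmf.prob found ?A \<and> expected_questions found \<le>
      ennreal (real m + log 2 (real ?n) + D + D\<^sup>2 * real ?n / (real m * real R) + 1)"
  proof (cases "q \<in> T")
    case True
    then have "found = return_pmf (q, 0)"
      unfolding assms(9) search_alg_def split_beta by (simp add: bind_pmf_const)
    moreover have "q \<in> nearest_neighbors d R q T"
      using True assms(7) by (simp add: nearest_neighbors_def)
    ultimately show ?thesis
      by (simp add: measure_return_pmf expected_questions_def)
  next
    case False
    obtain L c where run: "run (comparison_oracle d) (learn_alg T m) =
        map_pmf (\<lambda>xs. (L xs, c xs)) (pmf_of_set ?X)"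
      and L: "\<And>xs. set xs \<subseteq> T \<Longrightarrow> map fst (L xs) = xs \<and> (\<forall>(s, l) \<in> set (L xs). is_ranking d s T l) \<and>
       real (c xs) \<le> 2 * (real ?n * real (length xs) * log 2 (real ?n))"
      using run_learn_alg[OF assms(1,2,4,5)] by blast
    have X: "set_pmf (pmf_of_set ?X) = ?X"
      by (rule set_pmf_uniform_lists[OF assms(4,5)])
    have fnd: "found = bind_pmf (pmf_of_set ?X)
        (\<lambda>xs. run (comparison_oracle d) (search_alg T m R D (L xs) q))"
      by (simp add: assms(9) run bind_map_pmf)
    have Lprops: "length (L xs) = m" "fst ` set (L xs) = set xs" "fst ` set (L xs) \<subseteq> T"
      "\<forall>(s, l) \<in> set (L xs). is_ranking d s T l" if "xs \<in> ?X" for xs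
    proof -
      have "map fst (L xs) = xs" using that L by blast
      then show "length (L xs) = m" "fst ` set (L xs) = set xs" "fst ` set (L xs) \<subseteq> T"
        using that by (metis (mono_tags) length_map mem_Collect_eq, metis set_map,
          metis (mono_tags) set_map mem_Collect_eq)
      show "\<forall>(s, l) \<in> set (L xs). is_ranking d s T l" using that L by blast
    qed
    note search = run_search_alg[OF assms(1-3) False assms(4-8) Lprops(1,3,4)]
    have "1 / 2 * (1 / 4) \<le> measure_pmf.prob found ?A"
      unfolding fnd
      by (rule prob_bind_pmf_ge[OF prob_close_sample[OF assms(1-3) False assms(4-6)]], simp,
        rule search(2)) (use X Lprops(2) in auto)
    moreover have "expected_questions found \<le>
      ennreal (real m + log 2 (real ?n) + D + D\<^sup>2 * real ?n / (real m * real R) + 1)"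
    proof (rule expected_questions_le)
      fix u k assume "(u, k) \<in> set_pmf found"
      then obtain xs where "xs \<in> ?X"
        "(u, k) \<in> set_pmf (run (comparison_oracle d) (search_alg T m R D (L xs) q))"
        unfolding fnd set_bind_pmf X by blast
      then have "real k \<le> real m + D + D * real ?n / (real m * real R)"
        using search(1) by blast
      \<comment> \<open>The search cost is linear in \<open>D\<close>; passing to the square uses
        \<open>D \<ge> 1\<close>, which holds because \<open>q\<close> and any
        \<open>s \<in> T\<close> are two distinct objects.\<close>
      moreover have "D * real ?n / (real m * real R) \<le> D\<^sup>2 * real ?n / (real m * real R)"
      proof (intro divide_right_mono mult_right_mono)
        obtain s where "s \<in> T" using assms(5) by blast
        then have "1 \<le> D"
          using False rank_disorder_ge_1[of "insert q T" s q d] assms(4,8) by auto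
        then show "D \<le> D\<^sup>2" by (simp add: power2_eq_square)
      qed auto
      moreover have "0 \<le> log 2 (real ?n)"
        using assms(4,5) by (simp add: Suc_le_eq card_gt_0_iff)
      ultimately show "real k \<le> real m + log 2 (real ?n) + D + D\<^sup>2 * real ?n / (real m * real R) + 1"
        by linarith
    qed
    ultimately show ?thesis by simp
  qed
  then show "1 / 8 \<le> measure_pmf.prob found ?A"
    and "expected_questions found \<le>
      ennreal (real m + log 2 (real ?n) + D + D\<^sup>2 * real ?n / (real m * real R) + 1)" by auto
qed

text \<open>The witnesses are chosen before \<open>K\<close> and \<open>d\<close>, so distances
  reach them only through oracle answers, apart from the number \<open>D\<close> handed to the
  search. The constants are 2, from rounding the sorting depth, and \<open>1/8 = 1/2 * 1/4\<close>,
  from the two random stages.\<close>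

theorem theorem5:
  "\<exists>(learn :: 'k set \<Rightarrow> nat \<Rightarrow> ('k, ('k \<times> 'k list) list) alg)
    (search :: 'k set \<Rightarrow> nat \<Rightarrow> nat \<Rightarrow> real \<Rightarrow> ('k \<times> 'k list) list \<Rightarrow> 'k \<Rightarrow> ('k, 'k) alg)
    (C :: real) (p :: real). 0 < C \<and> 0 < p \<and>
    (\<forall>(K :: 'k set) (d :: 'k \<Rightarrow> 'k \<Rightarrow> real) (T :: 'k set) (n :: nat) (m :: nat) (R :: nat).
      distinct_distances K d \<longrightarrow> T \<subseteq> K \<longrightarrow> finite T \<longrightarrow> T \<noteq> {} \<longrightarrow> card T = n \<longrightarrow>
      1 \<le> m \<longrightarrow> 1 \<le> R \<longrightarrow>
      (let learned = run (comparison_oracle d) (learn T m) in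
        map_pmf (\<lambda>(L, c). map fst L) learned = pmf_of_set {xs. set xs \<subseteq> T \<and> length xs = m} \<and>
        (\<forall>(L, c) \<in> set_pmf learned. \<forall>(s, l) \<in> set L. is_ranking d s T l) \<and>
        expected_questions learned \<le> ennreal (C * (real n * real m * log 2 (real n))) \<and>
        (\<forall>q\<in>K.
          let D = rank_disorder d (insert q T);
              found = bind_pmf learned (\<lambda>(L, c). run (comparison_oracle d) (search T m R D L q))
          in measure_pmf.prob found {(u, c). u \<in> nearest_neighbors d R q T} \<ge> p \<and>
             expected_questions found
               \<le> ennreal (real m + log 2 (real n) + D + D\<^sup>2 * real n / (real m * real R) + 1))))"
proof (rule exI[of _ learn_alg], rule exI[of _ search_alg], rule exI[of _ 2],
    rule exI[of _ "1 / 8"], intro conjI allI impI)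
  fix K :: "'k set" and d T and n m R :: nat
  assume dd: "distinct_distances K d" "T \<subseteq> K" and T: "finite T" "T \<noteq> {}"
    and n: "card T = n" and mR: "1 \<le> m" "1 \<le> R"
  let ?X = "{xs. set xs \<subseteq> T \<and> length xs = m}"
  obtain L c where run: "run (comparison_oracle d) (learn_alg T m) =
      map_pmf (\<lambda>xs. (L xs, c xs)) (pmf_of_set ?X)"
    and L: "\<And>xs. set xs \<subseteq> T \<Longrightarrow> map fst (L xs) = xs \<and> (\<forall>(s, l) \<in> set (L xs). is_ranking d s T l) \<and>
     real (c xs) \<le> 2 * (real (card T) * real (length xs) * log 2 (real (card T)))"
    using run_learn_alg[OF dd T] by blast
  have X: "set_pmf (pmf_of_set ?X) = ?X"
    by (rule set_pmf_uniform_lists[OF T])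
  have "map_pmf (\<lambda>(L, c). map fst L) (run (comparison_oracle d) (learn_alg T m)) = map_pmf id (pmf_of_set ?X)"
    unfolding run pmf.map_comp using L X by (intro map_pmf_cong) auto
  moreover have "\<forall>(L, c) \<in> set_pmf (run (comparison_oracle d) (learn_alg T m)).
      \<forall>(s, l) \<in> set L. is_ranking d s T l"
    unfolding run set_map_pmf X using L by fastforce
  moreover have "expected_questions (run (comparison_oracle d) (learn_alg T m))
      \<le> ennreal (2 * (real n * real m * log 2 (real n)))"
    using L X n by (intro expected_questions_le) (auto simp: run)
  ultimately show "let learned = run (comparison_oracle d) (learn_alg T m) in
        map_pmf (\<lambda>(L, c). map fst L) learned = pmf_of_set {xs. set xs \<subseteq> T \<and> length xs = m} \<and>
        (\<forall>(L, c) \<in> set_pmf learned. \<forall>(s, l) \<in> set L. is_ranking d s T l) \<and>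
        expected_questions learned \<le> ennreal (2 * (real n * real m * log 2 (real n))) \<and>
        (\<forall>q\<in>K.
          let D = rank_disorder d (insert q T);
              found = bind_pmf learned (\<lambda>(L, c). run (comparison_oracle d) (search_alg T m R D L q))
          in measure_pmf.prob found {(u, c). u \<in> nearest_neighbors d R q T} \<ge> 1 / 8 \<and>
             expected_questions found
               \<le> ennreal (real m + log 2 (real n) + D + D\<^sup>2 * real n / (real m * real R) + 1))"
    unfolding Let_def
    using search_after_learn[OF dd _ T mR refl refl] n by (simp add: pmf.map_id)
qed simp_all

end
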